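(* Let $V\in L^\infty(\mathbb{R})$ satisfy $0<v_0\le V(x)\le v_1$ for a.e. $x\in\mathbb{R}$, for some constants $v_0,v_1$. Then $$m(V)=\inf_{a\in\mathbb{R}}F(a).$$
   Context: All function spaces are real-valued, $H^1(\mathbb{R})=W^{1,2}(\mathbb{R})$, and every $u\in H^1(\mathbb{R})$ is identified with its continuous representative. Write $\|u\|_\infty=\|u\|_{L^\infty(\mathbb{R})}$ and $$\|u\|_V^2=\int_{\mathbb{R}}\left(|u'(x)|^2+V(x)|u(x)|^2\right)dx .$$ Define $$m(V):=\inf_{u\in H^1(\mathbb{R}),\,u\not\equiv 0}\frac{\|u\|_V^2}{\|u\|_\infty^2}.$$ For $a\in\mathbb{R}$ set $K_a:=\{u\in H^1(\mathbb{R}):\ u(a)=\|u\|_\infty=1\}$ and $F(a):=\inf_{u\in K_a}\|u\|_V^2$. *)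

theory Defs
  imports "HOL-Analysis.Analysis" "HOL-Probability.Essential_Supremum"
begin

definition L2 :: "(real \<Rightarrow> real) set" where
  "L2 = {f. f \<in> borel_measurable lebesgue \<and> integrable lebesgue (\<lambda>x. \<bar>f x\<bar>\<^sup>2)}"

definition Linf :: "(real \<Rightarrow> real) set" where
  "Linf = {f. f \<in> borel_measurable lebesgue \<and> esssup lebesgue (\<lambda>x. ereal \<bar>f x\<bar>) < \<infinity>}"

definition Linf_norm :: "(real \<Rightarrow> real) \<Rightarrow> real" where
  "Linf_norm f = real_of_ereal (esssup lebesgue (\<lambda>x. ereal \<bar>f x\<bar>))"

definition locally_integrable :: "(real \<Rightarrow> real) \<Rightarrow> bool" where
  "locally_integrable f \<longleftrightarrow> (\<forall>K. compact K \<longrightarrow> f absolutely_integrable_on K)"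

definition test_function :: "(real \<Rightarrow> real) \<Rightarrow> bool" where
  "test_function \<phi> \<longleftrightarrow>
     (\<forall>k x. (deriv ^^ k) \<phi> field_differentiable (at x)) \<and> compact (closure {x. \<phi> x \<noteq> 0})"

definition has_weak_deriv :: "(real \<Rightarrow> real) \<Rightarrow> (real \<Rightarrow> real) \<Rightarrow> bool" where
  "has_weak_deriv u g \<longleftrightarrow> locally_integrable u \<and> locally_integrable g \<and>
     (\<forall>\<phi>. test_function \<phi> \<longrightarrow>
        (\<integral>x. u x * deriv \<phi> x \<partial>lebesgue) = - (\<integral>x. g x * \<phi> x \<partial>lebesgue))"

text \<open>Weak derivatives are unique only up to null sets. The choice below is immaterial
  in \<open>V_norm_sq\<close>, where it occurs only under an integral.\<close>

definition weak_deriv :: "(real \<Rightarrow> real) \<Rightarrow> real \<Rightarrow> real" where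
  "weak_deriv u = (SOME g. has_weak_deriv u g)"

text \<open>The elements of \<open>H1\<close> are functions rather than classes modulo null sets: each class of
  $H^1(\mathbb{R}) = W^{1,2}(\mathbb{R})$ is represented by its unique continuous member.\<close>

definition H1 :: "(real \<Rightarrow> real) set" where
  "H1 = {u. continuous_on UNIV u \<and> u \<in> L2 \<and> (\<exists>g\<in>L2. has_weak_deriv u g)}"

definition V_norm_sq :: "(real \<Rightarrow> real) \<Rightarrow> (real \<Rightarrow> real) \<Rightarrow> real" where
  "V_norm_sq V u = (\<integral>x. \<bar>weak_deriv u x\<bar>\<^sup>2 + V x * \<bar>u x\<bar>\<^sup>2 \<partial>lebesgue)"

text \<open>The infima below are taken in \<open>real\<close>, where \<open>Inf\<close> is meaningful only for nonempty sets
  bounded below. Nonnegativity of \<open>V\<close> gives the lower bound 0, and \<open>K a\<close> contains the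
  Gaussian centred at \<open>a\<close>.\<close>

definition m :: "(real \<Rightarrow> real) \<Rightarrow> real" where
  "m V = (INF u\<in>{u \<in> H1. u \<noteq> (\<lambda>_. 0)}. V_norm_sq V u / (Linf_norm u)\<^sup>2)"

definition K :: "real \<Rightarrow> (real \<Rightarrow> real) set" where
  "K a = {u \<in> H1. u a = Linf_norm u \<and> Linf_norm u = 1}"

definition F :: "(real \<Rightarrow> real) \<Rightarrow> real \<Rightarrow> real" where
  "F V a = (INF u\<in>K a. V_norm_sq V u)"

end

theory Submission
  imports Defs "HOL-Computational_Algebra.Polynomial"
begin

text \<open>The two infima run over essentially the same competitors. A member of \<open>K a\<close> has supremum norm \<open>1\<close>,
  so its energy is its Rayleigh quotient, and hence \<open>m V \<le> F V a\<close>. Conversely, a nonzero \<open>u\<close> in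
  \<open>H1\<close> vanishes at infinity, so \<open>\<bar>u\<bar>\<close> attains its maximum at some \<open>a\<close>
  (\<open>H1_attains_max_abs\<close>). Dividing \<open>u\<close> by \<open>u a\<close>, which normalizes the maximum and the sign at once,
  gives a member of \<open>K a\<close> whose energy equals the quotient of \<open>u\<close>, because both
  numerator and denominator are homogeneous of degree two.

  Two facts about weak derivatives are behind this. Homogeneity of the energy needs the weak
  derivative, which is only a chosen one, to be unique almost everywhere (\<open>weak_deriv_unique\<close>).
  Decay at infinity needs pointwise control of \<open>u\<close> by integrals of \<open>u\<close> and its weak derivative
  over short intervals (\<open>abs_le_unit_interval_integral\<close>). Both follow from a single fundamental
  theorem of calculus, \<open>u y - u x = \<integral>\<^sub>x\<^sup>y g\<close> for a continuous \<open>u\<close> with weak derivative \<open>g\<close>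
  (\<open>weak_deriv_FTC\<close>), which is obtained by testing with smooth approximations to the indicator
  function of the interval from \<open>x\<close> to \<open>y\<close>. These are built from a smooth step
  function, which also yields a compactly supported bump in each \<open>K a\<close>; without such a
  member the real infimum \<open>F V a\<close> would have no meaning.\<close>

section \<open>Smooth functions\<close>

text \<open>A recursion on the order of differentiability turns each closure property below into an
  induction; iterating \<open>deriv\<close> directly would require closed forms of all higher derivatives of
  products and reciprocals.\<close>

primrec times_differentiable :: "nat \<Rightarrow> (real \<Rightarrow> real) \<Rightarrow> bool" where
  "times_differentiable 0 f \<longleftrightarrow> True"
| "times_differentiable (Suc k) f \<longleftrightarrow>
     (\<exists>f'. (\<forall>x. (f has_real_derivative f' x) (at x)) \<and> times_differentiable k f')"

lemma times_differentiable_Suc_D: "times_differentiable (Suc k) f \<Longrightarrow> times_differentiable k f"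
  by (induction k arbitrary: f) (simp, metis times_differentiable.simps(2))

lemma times_differentiable_const: "times_differentiable k (\<lambda>_. c)"
proof (induction k arbitrary: c)
  case (Suc k)
  show ?case using Suc[of 0] by (auto intro!: exI[of _ "\<lambda>_. 0"])
qed simp

lemma times_differentiable_add:
  "times_differentiable k f \<Longrightarrow> times_differentiable k g \<Longrightarrow> times_differentiable k (\<lambda>x. f x + g x)"
proof (induction k arbitrary: f g)
  case (Suc k)
  then obtain f' g' where "\<forall>x. (f has_real_derivative f' x) (at x)" "times_differentiable k f'"
    "\<forall>x. (g has_real_derivative g' x) (at x)" "times_differentiable k g'"
    by auto
  with Suc.IH[of f' g'] show ?case
    by (auto intro!: exI[of _ "\<lambda>x. f' x + g' x"] derivative_eq_intros)
qed simp

lemma times_differentiable_mult: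
  "times_differentiable k f \<Longrightarrow> times_differentiable k g \<Longrightarrow> times_differentiable k (\<lambda>x. f x * g x)"
proof (induction k arbitrary: f g)
  case (Suc k)
  then obtain f' g' where "\<forall>x. (f has_real_derivative f' x) (at x)" "times_differentiable k f'"
    "\<forall>x. (g has_real_derivative g' x) (at x)" "times_differentiable k g'"
    by auto
  moreover have "times_differentiable k f" "times_differentiable k g"
    by (fact Suc.prems[THEN times_differentiable_Suc_D])+
  ultimately have "times_differentiable k (\<lambda>x. f' x * g x + f x * g' x)"
    by (intro times_differentiable_add Suc.IH)
  with \<open>\<forall>x. (f has_real_derivative f' x) (at x)\<close> \<open>\<forall>x. (g has_real_derivative g' x) (at x)\<close>
  show ?case
    by (auto intro!: exI[of _ "\<lambda>x. f' x * g x + f x * g' x"] derivative_eq_intros)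
qed simp

lemma times_differentiable_diff:
  assumes "times_differentiable k f" "times_differentiable k g"
  shows "times_differentiable k (\<lambda>x. f x - g x)"
  using times_differentiable_add[OF assms(1)
      times_differentiable_mult[OF times_differentiable_const[of k "-1"] assms(2)]]
  by simp

lemma times_differentiable_inverse:
  "times_differentiable k f \<Longrightarrow> (\<And>x. f x \<noteq> 0) \<Longrightarrow> times_differentiable k (\<lambda>x. inverse (f x))"
proof (induction k arbitrary: f)
  case (Suc k)
  then obtain f' where f': "\<forall>x. (f has_real_derivative f' x) (at x)" "times_differentiable k f'"
    by auto
  have "times_differentiable k (\<lambda>x. inverse (f x))"
    using Suc.IH[OF Suc.prems(1)[THEN times_differentiable_Suc_D]] Suc.prems(2) by blast
  then have "times_differentiable k (\<lambda>x. (- 1) * (inverse (f x) * f' x * inverse (f x)))"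
    by (intro times_differentiable_mult times_differentiable_const f')
  with f' Suc.prems(2) show ?case
    by (auto intro!: exI[of _ "\<lambda>x. (- 1) * (inverse (f x) * f' x * inverse (f x))"] 
        derivative_eq_intros)
qed simp

lemma times_differentiable_affine:
  "times_differentiable k f \<Longrightarrow> times_differentiable k (\<lambda>x. f (c * x + d))"
proof (induction k arbitrary: f)
  case (Suc k)
  then obtain f' where f': "\<forall>x. (f has_real_derivative f' x) (at x)" "times_differentiable k f'"
    by auto
  have "((\<lambda>x. f (c * x + d)) has_real_derivative c * f' (c * x + d)) (at x)" for x
  proof -
    have "((\<lambda>x. c * x + d) has_real_derivative c) (at x)"
      by (auto intro!: derivative_eq_intros)
    from DERIV_chain2[OF f'(1)[rule_format] this] show ?thesis by (simp add: mult.commute)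
  qed
  moreover have "times_differentiable k (\<lambda>x. c * f' (c * x + d))"
    using Suc.IH[OF f'(2)] by (intro times_differentiable_mult times_differentiable_const)
  ultimately show ?case by (auto intro!: exI[of _ "\<lambda>x. c * f' (c * x + d)"])
qed simp

lemma times_differentiable_deriv:
  assumes "times_differentiable (Suc k) f" shows "times_differentiable k (deriv f)"
proof -
  obtain f' where f': "\<forall>x. (f has_real_derivative f' x) (at x)" "times_differentiable k f'"
    using assms by auto
  then have "deriv f = f'" by (auto simp: DERIV_imp_deriv)
  with f' show ?thesis by simp
qed

lemma higher_deriv_differentiable:
  assumes "times_differentiable (Suc k) f" shows "(deriv ^^ k) f field_differentiable at x"
  using assms
proof (induction k arbitrary: f)
  case 0
  then show ?case by (auto simp: field_differentiable_def)
next
  case (Suc k)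
  then show ?case using times_differentiable_deriv[of "Suc k" f]
    by (simp add: funpow_Suc_right del: funpow.simps times_differentiable.simps)
qed

section \<open>A smooth step function\<close>

lemma poly_times_exp_minus_tendsto_0: "((\<lambda>x::real. poly p x * exp (- x)) \<longlongrightarrow> 0) at_top"
proof -
  have "((\<lambda>x::real. \<Sum>i\<le>degree p. coeff p i * (x ^ i / exp x)) \<longlongrightarrow> (\<Sum>i\<le>degree p. coeff p i * 0)) at_top"
    by (intro tendsto_intros tendsto_power_div_exp_0)
  then show ?thesis
    by (simp add: poly_altdef sum_distrib_right exp_minus divide_inverse mult.assoc)
qed

text \<open>The classical smooth function \<open>exp (- 1 / x)\<close>, extended by \<open>0\<close> to the left, is the case
  \<open>p = 1\<close>. The polynomial factor in \<open>1 / x\<close> makes the family closed under differentiation, and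
  this closure alone gives smoothness.\<close>

definition flat :: "real poly \<Rightarrow> real \<Rightarrow> real" where
  "flat p x = (if x > 0 then poly p (1 / x) * exp (- (1 / x)) else 0)"

lemma flat_has_derivative:
  "(flat p has_real_derivative flat ([:0, 0, 1:] * (p - pderiv p)) x) (at x)"
proof -
  consider "x < 0" | "x > 0" | "x = 0" by linarith
  then show ?thesis
  proof cases
    case 1
    have "((\<lambda>_. 0) has_real_derivative 0) (at x)" by simp
    then have "(flat p has_real_derivative 0) (at x)"
      by (rule has_field_derivative_transform_within_open[where S = "{..<0}"])
         (use 1 in \<open>auto simp: flat_def\<close>)
    then show ?thesis using 1 by (simp add: flat_def)
  next
    case 2
    have "((\<lambda>x. poly p (1 / x) * exp (- (1 / x))) has_real_derivative
        flat ([:0, 0, 1:] * (p - pderiv p)) x) (at x)"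
      using 2
      by (auto intro!: derivative_eq_intros DERIV_chain'[where g = "poly p"]
          simp: flat_def field_simps power2_eq_square)
    then show ?thesis
      by (rule has_field_derivative_transform_within_open[where S = "{0<..}"])
         (use 2 in \<open>auto simp: flat_def\<close>)
  next
    case 3
    \<comment> \<open>The difference quotient has one more factor \<open>1 / h\<close>, which \<open>pCons 0\<close> absorbs into the polynomial.\<close>
    have "((\<lambda>h. poly (pCons 0 p) (inverse h) * exp (- inverse h)) \<longlongrightarrow> 0) (at_right (0::real))"
      by (rule filterlim_compose[OF poly_times_exp_minus_tendsto_0 filterlim_inverse_at_top_right])
    then have r: "((\<lambda>h. flat p h / h) \<longlongrightarrow> 0) (at_right 0)"
      by (rule Lim_transform_eventually)
         (auto simp: eventually_at_filter flat_def field_simps)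
    have "((\<lambda>_. 0) \<longlongrightarrow> 0) (at_left (0::real))" by simp
    then have l: "((\<lambda>h. flat p h / h) \<longlongrightarrow> 0) (at_left 0)"
      by (rule Lim_transform_eventually)
         (auto simp: eventually_at_filter flat_def)
    have "((\<lambda>h. (flat p (0 + h) - flat p 0) / h) \<longlongrightarrow> 0) (at 0)"
      using filterlim_split_at[OF l r] by (simp add: flat_def)
    then show ?thesis using 3 by (simp add: DERIV_def flat_def)
  qed
qed

lemma times_differentiable_flat: "times_differentiable k (flat p)"
  by (induction k arbitrary: p) (auto intro: flat_has_derivative)

definition step :: "real \<Rightarrow> real" where
  "step x = flat 1 x * inverse (flat 1 x + flat 1 (1 - x))"

lemma flat_1_nonneg: "flat 1 x \<ge> 0" and flat_1_pos: "x > 0 \<Longrightarrow> flat 1 x > 0"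
  by (auto simp: flat_def)

lemma step_denominator_pos: "flat 1 x + flat 1 (1 - x) > 0"
  using flat_1_nonneg[of x] flat_1_nonneg[of "1 - x"] flat_1_pos[of x] flat_1_pos[of "1 - x"]
  by (cases "x > 0") auto

lemma times_differentiable_step: "times_differentiable k step"
proof -
  have "times_differentiable k (\<lambda>x. flat 1 ((-1) * x + 1))"
    by (intro times_differentiable_affine times_differentiable_flat)
  then have "times_differentiable k (\<lambda>x. flat 1 x * inverse (flat 1 x + flat 1 (1 - x)))"
    using step_denominator_pos
    by (intro times_differentiable_mult times_differentiable_inverse times_differentiable_add
        times_differentiable_flat) (auto simp: less_imp_neq[symmetric] add.commute)
  then show ?thesis by (simp add: step_def[abs_def])
qed

lemma step_eq_0: "x \<le> 0 \<Longrightarrow> step x = 0" by (simp add: step_def flat_def)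
lemma step_eq_1: "x \<ge> 1 \<Longrightarrow> step x = 1" by (simp add: step_def flat_def)
lemma step_nonneg: "step x \<ge> 0" 
  using flat_1_nonneg step_denominator_pos[of x] by (simp add: step_def)
lemma step_le_1: "step x \<le> 1"
  using flat_1_nonneg[of "1 - x"] step_denominator_pos[of x] 
  by (simp add: step_def divide_inverse[symmetric])

lemma deriv_eq_0_locally_constant:
  fixes f :: "real \<Rightarrow> real"
  assumes "open S" "x \<in> S" "\<And>t. t \<in> S \<Longrightarrow> f t = c"
  shows "deriv f x = 0"
proof -
  have "((\<lambda>_. c) has_real_derivative 0) (at x)" by simp
  then have "(f has_real_derivative 0) (at x)"
    by (rule has_field_derivative_transform_within_open) (use assms in auto)
  then show ?thesis by (rule DERIV_imp_deriv)
qed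

lemma step_has_derivative: "(step has_real_derivative deriv step x) (at x)"
  using times_differentiable_step[of 1] by (auto simp: DERIV_deriv_iff_real_differentiable real_differentiable_def)

lemma continuous_deriv_step: "continuous_on S (deriv step)"
proof -
  have "times_differentiable 1 (deriv step)"
    using times_differentiable_deriv[OF times_differentiable_step] by blast
  then show ?thesis
    by (metis (no_types) One_nat_def times_differentiable.simps(2) DERIV_isCont continuous_at_imp_continuous_on)
qed

lemma deriv_step_outside: "x \<notin> {0..1} \<Longrightarrow> deriv step x = 0"
  using deriv_eq_0_locally_constant[of "{..<0}" x step 0]
    deriv_eq_0_locally_constant[of "{1<..}" x step 1]
  by (auto simp: step_eq_0 step_eq_1 not_le)

lemma lebesgue_integral_lborel:
  fixes f :: "real \<Rightarrow> real"
  assumes "continuous_on UNIV f"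
  shows "(\<integral>x. f x \<partial>lebesgue) = (\<integral>x. f x \<partial>lborel)"
  using assms by (intro integral_completion) (simp add: borel_measurable_continuous_onI)

lemma integrable_compact_support:
  fixes f :: "real \<Rightarrow> real"
  assumes "continuous_on UNIV f" and supp: "\<And>t. t \<notin> {a..b} \<Longrightarrow> f t = 0"
  shows "integrable lebesgue f"
proof -
  have "set_integrable lebesgue {a..b} f"
    by (intro absolutely_integrable_continuous_real continuous_on_subset[OF assms(1)]) auto
  moreover have "(\<lambda>t. indicator {a..b} t *\<^sub>R f t) = f"
    using supp by (auto simp: indicator_def fun_eq_iff)
  ultimately show ?thesis by (simp add: set_integrable_def)
qed

section \<open>The fundamental theorem of calculus for weak derivatives\<close>

text \<open>The rescaled derivatives of \<open>step\<close> concentrate at \<open>x\<close> and have total mass \<open>step 1 - step 0 = 1\<close>,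
  so they act as a mollifier; continuity of \<open>u\<close> at \<open>x\<close> identifies the limit. Substituting
  \<open>t = x + s / n\<close> moves the dependence on \<open>n\<close> into the continuous factor, where dominated
  convergence applies.\<close>

lemma step_mollifier_tendsto:
  assumes u: "continuous_on UNIV u"
  shows "(\<lambda>n. \<integral>t. u t * (real (Suc n) * deriv step (real (Suc n) * (t - x))) \<partial>lebesgue) \<longlonglongrightarrow> u x"
proof -
  have cd: "continuous_on UNIV (deriv step)" by (rule continuous_deriv_step)
  have rescale: "(\<integral>t. u t * (c * deriv step (c * (t - x))) \<partial>lebesgue)
      = (\<integral>s. u (x + s / c) * deriv step s \<partial>lborel)" if "c > 0" for c
  proof -
    have "(\<integral>t. u t * (c * deriv step (c * (t - x))) \<partial>lebesgue)
        = (\<integral>t. u t * (c * deriv step (c * (t - x))) \<partial>lborel)"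
      by (intro lebesgue_integral_lborel continuous_intros u continuous_on_compose2[OF cd]) auto
    also have "\<dots> = \<bar>1 / c\<bar> *\<^sub>R (\<integral>s. u (x + 1 / c * s) * (c * deriv step (c * (x + 1 / c * s - x))) \<partial>lborel)"
      using that by (intro lborel_integral_real_affine) auto
    also have "\<dots> = \<bar>1 / c\<bar> *\<^sub>R (\<integral>s. c * (u (x + s / c) * deriv step s) \<partial>lborel)"
      using that by (simp add: mult_ac)
    also have "\<dots> = (\<integral>s. u (x + s / c) * deriv step s \<partial>lborel)"
      using that by simp
    finally show ?thesis .
  qed
  have "bounded (u ` {x..x+1})" "bounded (deriv step ` {0..1})"
    by (intro compact_imp_bounded compact_continuous_image compact_Icc
        continuous_on_subset[OF u] continuous_deriv_step; simp)+
  then obtain A B where A: "\<And>t. t \<in> {x..x+1} \<Longrightarrow> \<bar>u t\<bar> \<le> A"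
    and B: "\<And>s. s \<in> {0..1} \<Longrightarrow> \<bar>deriv step s\<bar> \<le> B"
    unfolding bounded_iff by (metis imageI real_norm_def)
  have "(\<lambda>n. \<integral>s. u (x + s / real (Suc n)) * deriv step s \<partial>lborel) \<longlonglongrightarrow> (\<integral>s. u x * deriv step s \<partial>lborel)"
  proof (rule integral_dominated_convergence[where w = "\<lambda>s. (A * B) * indicator {0..1} s"])
    show "integrable lborel (\<lambda>s::real. (A * B) * indicator {0..1} s)"
      by (intro integrable_mult_right) simp
    show "(\<lambda>s. u x * deriv step s) \<in> borel_measurable lborel"
      using borel_measurable_continuous_onI[OF cd] by simp
    show "(\<lambda>s. u (x + s / real (Suc n)) * deriv step s) \<in> borel_measurable lborel" for n
      unfolding measurable_lborel2
      by (intro borel_measurable_continuous_onI continuous_intros cd continuous_on_compose2[OF u]) auto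
    show "AE s in lborel. (\<lambda>n. u (x + s / real (Suc n)) * deriv step s) \<longlonglongrightarrow> u x * deriv step s"
    proof (intro AE_I2 tendsto_intros)
      fix s :: real
      have "(\<lambda>n. s / real (Suc n)) \<longlonglongrightarrow> 0"
        using tendsto_mult[OF tendsto_const[of s] LIMSEQ_inverse_real_of_nat] by (simp add: divide_inverse)
      then have "(\<lambda>n. x + s / real (Suc n)) \<longlonglongrightarrow> x"
        using tendsto_add[OF tendsto_const[of x]] by fastforce
      then show "(\<lambda>n. u (x + s / real (Suc n))) \<longlonglongrightarrow> u x"
        using u by (intro isCont_tendsto_compose[of x u]) (simp_all add: continuous_on_eq_continuous_at)
    qed
    show "AE s in lborel. norm (u (x + s / real (Suc n)) * deriv step s) \<le> (A * B) * indicator {0..1} s" for n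
    proof (rule AE_I2)
      fix s :: real
      show "norm (u (x + s / real (Suc n)) * deriv step s) \<le> (A * B) * indicator {0..1} s"
      proof (cases "s \<in> {0..1}")
        case True
        then have "x + s / real (Suc n) \<in> {x..x+1}" by (auto simp: divide_le_eq_1)
        then have "\<bar>u (x + s / real (Suc n))\<bar> \<le> A" by (rule A)
        then show ?thesis using B[OF True] True 
          by (simp add: abs_mult) (intro mult_mono, auto)
      qed (simp add: deriv_step_outside)
    qed
  qed
  moreover have "(\<integral>s. u x * deriv step s \<partial>lborel) = u x"
  proof -
    have "(\<integral>s. deriv step s \<partial>lborel) = (\<integral>s. deriv step s * indicator {0..1} s \<partial>lborel)"
    proof (rule Bochner_Integration.integral_cong[OF refl])
      show "deriv step s = deriv step s * indicator {0..1} s" for s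
        by (cases "s \<in> {0..1}") (simp_all add: deriv_step_outside)
    qed
    also have "\<dots> = step 1 - step 0"
      using continuous_deriv_step[of UNIV]
      by (intro integral_FTC_Icc_real step_has_derivative) (auto simp: continuous_on_eq_continuous_at)
    finally show ?thesis by (simp add: step_eq_0 step_eq_1)
  qed
  ultimately show ?thesis by (simp only: rescale of_nat_0_less_iff zero_less_Suc)
qed

lemma step_scaled_tendsto: "(\<lambda>n. step (real (Suc n) * z)) \<longlonglongrightarrow> (if z > 0 then 1 else 0)"
proof (cases "z > 0")
  case True
  then obtain N where N: "1 < real N * z" by (metis reals_Archimedean3)
  have "step (real (Suc n) * z) = 1" if "n \<ge> N" for n
  proof (rule step_eq_1)
    have "real N * z \<le> real (Suc n) * z" using that True by (intro mult_right_mono) auto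
    with N show "real (Suc n) * z \<ge> 1" by linarith
  qed
  then show ?thesis using True by (auto intro!: tendsto_eventually eventually_sequentiallyI[of N] simp del: of_nat_Suc)
next
  case False
  then have "step (real (Suc n) * z) = 0" for n by (intro step_eq_0) (simp add: mult_nonneg_nonpos)
  then show ?thesis using False by (simp del: of_nat_Suc)
qed

lemma locally_integrable_measurable:
  assumes "locally_integrable g" shows "g \<in> borel_measurable lebesgue"
proof (rule borel_measurable_LIMSEQ_real)
  show "(\<lambda>x. indicator {- real n..real n} x *\<^sub>R g x) \<in> borel_measurable lebesgue" for n
    using assms by (auto simp: locally_integrable_def set_integrable_def intro!: borel_measurable_integrable)
  fix x :: real
  obtain N where "\<bar>x\<bar> \<le> real N" using real_arch_simple by blast
  then show "(\<lambda>n. indicator {- real n..real n} x *\<^sub>R g x) \<longlonglongrightarrow> g x"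
    by (intro tendsto_eventually eventually_sequentiallyI[of N]) (auto simp: indicator_def)
qed

lemma test_functionI:
  assumes "\<And>k. times_differentiable k \<phi>" "\<And>t. t \<notin> {a..b} \<Longrightarrow> \<phi> t = 0"
  shows "test_function \<phi>"
  unfolding test_function_def
proof
  show "\<forall>k x. (deriv ^^ k) \<phi> field_differentiable (at x)"
    using assms(1) higher_deriv_differentiable by blast
  have "bounded {x. \<phi> x \<noteq> 0}"
  proof (rule bounded_subset[OF bounded_closed_interval])
    show "{x. \<phi> x \<noteq> 0} \<subseteq> {a..b}" using assms(2) by blast
  qed
  then show "compact (closure {x. \<phi> x \<noteq> 0})" by simp
qed

text \<open>Test the weak derivative with \<open>\<phi> n t = step (n (t - x)) - step (n (t - y))\<close>. As \<open>n\<close> grows, \<open>\<phi> n\<close>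
  tends to the indicator of the interval, so the side with \<open>g\<close> gives the integral, while
  the derivatives of \<open>\<phi> n\<close> are the difference of two mollifiers at \<open>x\<close> and \<open>y\<close>, so the side
  with \<open>u\<close> gives the endpoint values.\<close>

lemma weak_deriv_FTC:
  assumes u: "continuous_on UNIV u" and g: "has_weak_deriv u g" and xy: "x \<le> y"
  shows "u y - u x = (LINT t:{x..y}|lebesgue. g t)"
proof -
  have lg: "locally_integrable g" using g by (simp add: has_weak_deriv_def)
  note [measurable] = locally_integrable_measurable[OF lg]
  define \<phi> where "\<phi> n t = step (real (Suc n) * (t - x)) - step (real (Suc n) * (t - y))" for n t
  have smooth: "times_differentiable k (\<phi> n)" for k n
  proof -
    have "times_differentiable k (\<lambda>t. step (real (Suc n) * t + real (Suc n) * (- z)))" for z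
      by (intro times_differentiable_affine times_differentiable_step)
    then have "times_differentiable k (\<lambda>t. step (real (Suc n) * (t - z)))" for z
      by (simp add: right_diff_distrib del: of_nat_Suc)
    then show ?thesis unfolding \<phi>_def[abs_def] by (intro times_differentiable_diff)
  qed
  have supp: "\<phi> n t = 0" if "t \<notin> {x..y+1}" for n t
  proof -
    have "t < x \<or> t > y + 1" using that by auto
    then consider "t < x" | "t > y + 1" by blast
    then show ?thesis
    proof cases
      case 1
      then show ?thesis using xy by (simp add: \<phi>_def step_eq_0 mult_nonneg_nonpos del: of_nat_Suc)
    next
      case 2
      have "real (Suc n) * z \<ge> 1" if "z \<ge> 1" for z
        using mult_mono[of 1 "real (Suc n)" 1 z] that by simp
      then show ?thesis using 2 xy by (simp add: \<phi>_def step_eq_1 del: of_nat_Suc)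
    qed
  qed
  have deriv_\<phi>: "deriv (\<phi> n) t = real (Suc n) * deriv step (real (Suc n) * (t - x))
      - real (Suc n) * deriv step (real (Suc n) * (t - y))" for n t
  proof (rule DERIV_imp_deriv)
    have "((\<lambda>t. step (real (Suc n) * (t - z))) has_real_derivative
        deriv step (real (Suc n) * (t - z)) * real (Suc n)) (at t)" for z
      by (rule DERIV_chain2[OF step_has_derivative]) (auto intro!: derivative_eq_intros)
    from DERIV_diff[OF this[of x] this[of y]]
    show "(\<phi> n has_real_derivative real (Suc n) * deriv step (real (Suc n) * (t - x))
      - real (Suc n) * deriv step (real (Suc n) * (t - y))) (at t)"
      unfolding \<phi>_def[abs_def] by (simp add: mult.commute del: of_nat_Suc)
  qed
  have weak: "(\<integral>t. u t * deriv (\<phi> n) t \<partial>lebesgue) = - (\<integral>t. g t * \<phi> n t \<partial>lebesgue)" for n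
    using g test_functionI[OF smooth supp] by (auto simp: has_weak_deriv_def)
  have "(\<lambda>n. \<integral>t. u t * deriv (\<phi> n) t \<partial>lebesgue) \<longlonglongrightarrow> u x - u y"
  proof -
    have int: "integrable lebesgue (\<lambda>t. u t * (real (Suc n) * deriv step (real (Suc n) * (t - z))))" for n z
    proof (rule integrable_compact_support[of _ z "z + 1"])
      show "continuous_on UNIV (\<lambda>t. u t * (real (Suc n) * deriv step (real (Suc n) * (t - z))))"
        by (intro continuous_intros u continuous_on_compose2[OF continuous_deriv_step[of UNIV]]) auto
      fix t assume t: "t \<notin> {z..z+1}"
      \<comment> \<open>Since the scale \<open>Suc n\<close> is at least \<open>1\<close>, the support has length at most \<open>1\<close>.\<close>
      have "real (Suc n) * (t - z) \<notin> {0..1}"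
      proof
        assume *: "real (Suc n) * (t - z) \<in> {0..1}"
        then have "t - z \<ge> 0" by (simp add: zero_le_mult_iff del: of_nat_Suc)
        moreover from this have "1 * (t - z) \<le> real (Suc n) * (t - z)" by (intro mult_right_mono) auto
        ultimately show False using * t by auto
      qed
      then show "u t * (real (Suc n) * deriv step (real (Suc n) * (t - z))) = 0"
        by (simp add: deriv_step_outside del: of_nat_Suc)
    qed
    show ?thesis
      using tendsto_diff[OF step_mollifier_tendsto[OF u, of x] step_mollifier_tendsto[OF u, of y]]
      by (simp only: deriv_\<phi> right_diff_distrib[of "u _"] Bochner_Integration.integral_diff[OF int int])
  qed
  moreover have "(\<lambda>n. \<integral>t. g t * \<phi> n t \<partial>lebesgue) \<longlonglongrightarrow> (\<integral>t. g t * indicator {x<..y} t \<partial>lebesgue)"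
  proof (rule integral_dominated_convergence[where w = "\<lambda>t. norm (indicator {x..y+1} t *\<^sub>R g t)"])
    show "integrable lebesgue (\<lambda>t. norm (indicator {x..y+1} t *\<^sub>R g t))"
      using lg unfolding locally_integrable_def set_integrable_def by (intro integrable_norm) auto
    show "(\<lambda>t. g t * indicator {x<..y} t) \<in> borel_measurable lebesgue"
      by (intro borel_measurable_times borel_measurable_indicator) auto
    have "continuous_on UNIV (\<phi> n)" for n
      using smooth[of 1 n] by (auto intro: DERIV_isCont continuous_at_imp_continuous_on)
    then have [measurable]: "\<phi> n \<in> borel_measurable lebesgue" for n
      by (intro measurable_completion) (simp add: borel_measurable_continuous_onI)
    show "(\<lambda>t. g t * \<phi> n t) \<in> borel_measurable lebesgue" for n by measurable
    show "AE t in lebesgue. (\<lambda>n. g t * \<phi> n t) \<longlonglongrightarrow> g t * indicator {x<..y} t"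
    proof (rule AE_I2, rule tendsto_mult_left)
      fix t
      have "(\<lambda>n. \<phi> n t) \<longlonglongrightarrow> (if t - x > 0 then 1 else 0) - (if t - y > 0 then 1 else 0)"
        unfolding \<phi>_def by (intro tendsto_diff step_scaled_tendsto)
      also have "(if t - x > 0 then 1 else 0) - (if t - y > 0 then 1 else 0) = indicat_real {x<..y} t"
        using xy by (auto simp: indicator_def)
      finally show "(\<lambda>n. \<phi> n t) \<longlonglongrightarrow> indicator {x<..y} t" .
    qed
    show "AE t in lebesgue. norm (g t * \<phi> n t) \<le> norm (indicator {x..y+1} t *\<^sub>R g t)" for n
    proof (rule AE_I2)
      fix t
      have "\<bar>\<phi> n t\<bar> \<le> 1"
        unfolding \<phi>_def using step_nonneg step_le_1 by (smt (verit))
      then have "\<bar>g t\<bar> * \<bar>\<phi> n t\<bar> \<le> \<bar>g t\<bar>" by (simp add: mult_left_le)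
      then show "norm (g t * \<phi> n t) \<le> norm (indicator {x..y+1} t *\<^sub>R g t)"
        using supp[of t n] by (cases "t \<in> {x..y+1}") (simp_all add: abs_mult)
    qed
  qed
  ultimately have "- (u x - u y) = (\<integral>t. g t * indicator {x<..y} t \<partial>lebesgue)"
    using LIMSEQ_unique[OF tendsto_minus] by (fastforce simp: weak)
  also have "\<dots> = (LINT t:{x..y}|lebesgue. g t)"
  proof -
    \<comment> \<open>The limit is half-open because \<open>step 0 = 0\<close>, so the endpoint \<open>x\<close> is added as a null set.\<close>
    have "AE t in lebesgue. t \<noteq> x" by (rule AE_completion[OF AE_lborel_singleton])
    then have "AE t in lebesgue. g t * indicator {x<..y} t = indicator {x..y} t *\<^sub>R g t"
      by (rule eventually_mono) (auto simp: indicator_def)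
    then show ?thesis unfolding set_lebesgue_integral_def
      by (intro integral_cong_AE borel_measurable_times borel_measurable_scaleR
          borel_measurable_indicator) auto
  qed
  finally show ?thesis by simp
qed

text \<open>The difference of two weak derivatives has integral \<open>0\<close> over every interval, by the fundamental
  theorem. Almost every point is a limit of the averages over shrinking intervals to its right, so
  the difference vanishes there.\<close>

lemma weak_deriv_unique:
  assumes u: "continuous_on UNIV u" and g: "has_weak_deriv u g" and h: "has_weak_deriv u h"
  shows "AE x in lebesgue. g x = h x"
proof -
  let ?f = "\<lambda>t. g t - h t"
  have int: "set_integrable lebesgue {x..y} g" "set_integrable lebesgue {x..y} h" for x y
    using g h by (auto simp: has_weak_deriv_def locally_integrable_def)
  have f0: "integral {x..y} ?f = 0" if "x \<le> y" for x y
    using weak_deriv_FTC[OF u g that] weak_deriv_FTC[OF u h that]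
    by (simp add: set_lebesgue_integral_eq_integral[OF int(1)] set_lebesgue_integral_eq_integral[OF int(2)]
        Henstock_Kurzweil_Integration.integral_diff)
  have "?f integrable_on cbox x y" for x y
    using set_lebesgue_integral_eq_integral(1)[OF int(1)] set_lebesgue_integral_eq_integral(1)[OF int(2)]
    by (simp add: integrable_diff)
  then obtain N where N: "negligible N"
    and d: "\<And>x e. x \<notin> N \<Longrightarrow> 0 < e \<Longrightarrow> \<exists>d>0. \<forall>t. 0 < t \<and> t < d \<longrightarrow>
        norm (integral (cbox x (x + t *\<^sub>R One)) ?f /\<^sub>R t ^ DIM(real) - ?f x) < e"
    using integrable_ccontinuous_explicit[of ?f] by blast
  have "?f x = 0" if x: "x \<notin> N" for x
  proof (rule ccontr)
    assume "?f x \<noteq> 0"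
    then obtain \<delta> where "\<delta> > 0" and
      \<delta>: "\<And>t. 0 < t \<Longrightarrow> t < \<delta> \<Longrightarrow> norm (integral (cbox x (x + t *\<^sub>R One)) ?f /\<^sub>R t ^ DIM(real) - ?f x) < \<bar>?f x\<bar>"
      using d[OF x, of "\<bar>?f x\<bar>"] by fastforce
    then show False using \<delta>[of "\<delta> / 2"] f0[of x "x + \<delta> / 2"] by simp
  qed
  then have "{x. g x \<noteq> h x} \<subseteq> N" by auto
  then have "negligible {x. g x \<noteq> h x}" using N negligible_subset by blast
  then show ?thesis
    using AE_not_in[of "{x. g x \<noteq> h x}" lebesgue] by (simp add: negligible_iff_null_sets)
qed

section \<open>Decay at infinity and the supremum norm\<close>

lemma unit_interval_integrals_vanish_at_infinity:
  fixes h :: "real \<Rightarrow> real"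
  assumes h: "integrable lebesgue h" and nonneg: "\<And>t. h t \<ge> 0" and "\<epsilon> > 0"
  obtains R where "\<And>x. \<bar>x\<bar> \<ge> R \<Longrightarrow> (LINT t:{x..x+1}|lebesgue. h t) < \<epsilon>"
proof -
  let ?S = "\<lambda>n::nat. - {- real n..real n}"
  have int: "integrable lebesgue (\<lambda>t. indicator (A :: real set) t * h t)" if "A \<in> sets lebesgue" for A
    using integrable_mult_indicator[OF that h] by simp
  have "(\<lambda>n. \<integral>t. indicator (?S n) t * h t \<partial>lebesgue) \<longlonglongrightarrow> integral\<^sup>L lebesgue (\<lambda>t::real. 0)"
  proof (rule integral_dominated_convergence[where w = h])
    show "AE t in lebesgue. (\<lambda>n. indicator (?S n) t * h t) \<longlonglongrightarrow> 0"
    proof (rule AE_I2)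
      fix t :: real
      obtain N where "\<bar>t\<bar> \<le> real N" using real_arch_simple by blast
      then show "(\<lambda>n. indicator (?S n) t * h t) \<longlonglongrightarrow> 0"
        by (intro tendsto_eventually eventually_sequentiallyI[of N]) (auto simp: indicator_def)
    qed
    show "AE t in lebesgue. norm (indicator (?S n) t * h t) \<le> h t" for n
      using nonneg by (intro AE_I2) (auto simp: indicator_def)
    show "(\<lambda>t. indicator (?S n) t * h t) \<in> borel_measurable lebesgue" for n
      by (rule borel_measurable_integrable[OF int]) auto
  qed (use h in auto)
  then have "eventually (\<lambda>n. (\<integral>t. indicator (?S n) t * h t \<partial>lebesgue) < \<epsilon>) sequentially"
    using \<open>\<epsilon> > 0\<close> by (intro order_tendstoD) auto
  then obtain n where n: "(\<integral>t. indicator (?S n) t * h t \<partial>lebesgue) < \<epsilon>"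
    using eventually_happens'[OF sequentially_bot] by blast
  show thesis
  proof (rule that[of "real n + 2"])
    fix x :: real assume "\<bar>x\<bar> \<ge> real n + 2"
    then have "{x..x+1} \<subseteq> ?S n" by auto
    then have "(\<integral>t. indicator {x..x+1} t * h t \<partial>lebesgue) \<le> (\<integral>t. indicator (?S n) t * h t \<partial>lebesgue)"
      by (intro integral_mono int) (use nonneg in \<open>auto simp: indicator_def\<close>)
    with n show "(LINT t:{x..x+1}|lebesgue. h t) < \<epsilon>"
      by (simp add: set_lebesgue_integral_def)
  qed
qed

text \<open>For every \<open>y\<close> in the unit interval, \<open>\<bar>u x\<bar>\<close> exceeds \<open>\<bar>u y\<bar>\<close> by at most the integral of \<open>\<bar>g\<bar>\<close>;
  averaging over \<open>y\<close> gives the bound.\<close>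

lemma abs_le_unit_interval_integral:
  assumes u: "continuous_on UNIV u" and g: "has_weak_deriv u g"
  shows "\<bar>u x\<bar> \<le> (LINT t:{x..x+1}|lebesgue. \<bar>u t\<bar> + \<bar>g t\<bar>)"
proof -
  have ug: "set_integrable lebesgue {a..b} u" "set_integrable lebesgue {a..b} g" for a b
    using g by (auto simp: has_weak_deriv_def locally_integrable_def)
  define G where "G = (LINT t:{x..x+1}|lebesgue. \<bar>g t\<bar>)"
  have close: "\<bar>u x\<bar> - G \<le> \<bar>u y\<bar>" if y: "y \<in> {x..x+1}" for y
  proof -
    have "\<bar>u y - u x\<bar> = \<bar>LINT t:{x..y}|lebesgue. g t\<bar>"
      using weak_deriv_FTC[OF u g, of x y] y by simp
    also have "\<dots> \<le> (LINT t:{x..y}|lebesgue. \<bar>g t\<bar>)"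
      using set_integral_norm_bound[OF ug(2)] by simp
    also have "\<dots> \<le> G"
      unfolding G_def set_lebesgue_integral_def
      using set_integrable_abs[OF ug(2), unfolded set_integrable_def] y
      by (intro integral_mono) (auto simp: indicator_def)
    finally show ?thesis by linarith
  qed
  have const: "set_integrable lebesgue {x..x+1} (\<lambda>_. \<bar>u x\<bar> - G)"
    by (intro absolutely_integrable_continuous_real continuous_intros)
  have "\<bar>u x\<bar> - G = (LINT t:{x..x+1}|lebesgue. \<bar>u x\<bar> - G)"
    by (simp add: set_lebesgue_integral_def)
  also have "\<dots> \<le> (LINT t:{x..x+1}|lebesgue. \<bar>u t\<bar>)"
    by (intro set_integral_mono const set_integrable_abs ug close)
  finally show ?thesis
    using set_integral_add(2)[OF set_integrable_abs[OF ug(1)] set_integrable_abs[OF ug(2)]]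
    by (simp add: G_def)
qed

text \<open>Young's inequality \<open>\<bar>a\<bar> \<le> \<epsilon> / 4 + a\<^sup>2 / \<epsilon>\<close> replaces \<open>\<bar>u\<bar> + \<bar>g\<bar>\<close> in the preceding bound by
  \<open>\<epsilon> / 2\<close> plus a multiple of the integrable function \<open>u\<^sup>2 + g\<^sup>2\<close>, whose integrals over distant
  unit intervals are small.\<close>

lemma H1_vanishes_at_infinity:
  assumes "u \<in> H1" "\<epsilon> > 0"
  obtains R where "\<And>x. \<bar>x\<bar> \<ge> R \<Longrightarrow> \<bar>u x\<bar> < \<epsilon>"
proof -
  from assms obtain g where u: "continuous_on UNIV u" and g: "has_weak_deriv u g"
    and L2: "u \<in> L2" "g \<in> L2"
    by (auto simp: H1_def)
  define h where "h t = \<bar>u t\<bar>\<^sup>2 + \<bar>g t\<bar>\<^sup>2" for t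
  have h: "integrable lebesgue h" and h_nonneg: "h t \<ge> 0" for t
    using L2 by (auto simp: L2_def h_def[abs_def])
  have "\<epsilon>\<^sup>2 / 2 > 0" using assms by simp
  then obtain R where R: "\<And>x. \<bar>x\<bar> \<ge> R \<Longrightarrow> (LINT t:{x..x+1}|lebesgue. h t) < \<epsilon>\<^sup>2 / 2"
    using unit_interval_integrals_vanish_at_infinity[OF h h_nonneg] by metis
  have set_h: "set_integrable lebesgue {x..x+1} h" for x
    unfolding set_integrable_def using h by (intro integrable_mult_indicator) auto
  have set_ug: "set_integrable lebesgue {x..x+1} (\<lambda>t. \<bar>u t\<bar> + \<bar>g t\<bar>)" for x
    using g by (intro set_integral_add set_integrable_abs) (auto simp: has_weak_deriv_def locally_integrable_def)
  have set_c: "set_integrable lebesgue {x..x+1} (\<lambda>_. c :: real)" for x :: real and c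
    by (intro absolutely_integrable_continuous_real continuous_intros)
  have young: "\<bar>a\<bar> \<le> \<epsilon> / 4 + \<bar>a\<bar>\<^sup>2 / \<epsilon>" for a
  proof -
    have "0 \<le> (\<bar>a\<bar> - \<epsilon> / 2)\<^sup>2 / \<epsilon>" using assms by simp
    also have "\<dots> = \<bar>a\<bar>\<^sup>2 / \<epsilon> - \<bar>a\<bar> + \<epsilon> / 4"
      using assms by (simp add: field_simps power2_eq_square)
    finally show ?thesis by linarith
  qed
  show thesis
  proof (rule that)
    fix x assume "\<bar>x\<bar> \<ge> R"
    have "\<bar>u x\<bar> \<le> (LINT t:{x..x+1}|lebesgue. \<bar>u t\<bar> + \<bar>g t\<bar>)"
      by (rule abs_le_unit_interval_integral[OF u g])
    also have "\<dots> \<le> (LINT t:{x..x+1}|lebesgue. \<epsilon> / 2 + 1 / \<epsilon> * h t)"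
    proof (intro set_integral_mono set_ug set_integral_add set_c set_integrable_mult_right set_h)
      fix t show "\<bar>u t\<bar> + \<bar>g t\<bar> \<le> \<epsilon> / 2 + 1 / \<epsilon> * h t"
        using young[of "u t"] young[of "g t"] by (simp add: h_def add_divide_distrib)
    qed
    also have "\<dots> = (LINT t:{x..x+1}|lebesgue. \<epsilon> / 2) + 1 / \<epsilon> * (LINT t:{x..x+1}|lebesgue. h t)"
      by (subst set_integral_add(2)) (auto intro!: set_c set_integrable_mult_right set_h)
    also have "(LINT t:{x..x+1}|lebesgue. \<epsilon> / 2) = \<epsilon> / 2"
      by (simp add: set_lebesgue_integral_def)
    also have "\<epsilon> / 2 + 1 / \<epsilon> * (LINT t:{x..x+1}|lebesgue. h t) < \<epsilon> / 2 + 1 / \<epsilon> * (\<epsilon>\<^sup>2 / 2)"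
      using R[OF \<open>\<bar>x\<bar> \<ge> R\<close>] assms by (intro add_strict_left_mono mult_strict_left_mono) auto
    also have "\<dots> = \<epsilon>" using assms by (simp add: power2_eq_square)
    finally show "\<bar>u x\<bar> < \<epsilon>" .
  qed
qed

text \<open>Far out, \<open>\<bar>u\<bar>\<close> is below its value at one point where \<open>u\<close> does not vanish, so only a
  compact interval matters.\<close>

lemma H1_attains_max_abs:
  assumes u: "u \<in> H1" and "u \<noteq> (\<lambda>_. 0)"
  obtains a where "u a \<noteq> 0" "\<And>x. \<bar>u x\<bar> \<le> \<bar>u a\<bar>"
proof -
  obtain p where p: "u p \<noteq> 0" using assms by auto
  then obtain R where R: "\<And>x. \<bar>x\<bar> \<ge> R \<Longrightarrow> \<bar>u x\<bar> < \<bar>u p\<bar>"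
    using H1_vanishes_at_infinity[OF u, of "\<bar>u p\<bar>"] by auto
  then have "\<bar>p\<bar> < R" by (meson less_irrefl not_le)
  have "continuous_on {-R..R} (\<lambda>x. \<bar>u x\<bar>)"
    using u by (auto simp: H1_def intro!: continuous_intros intro: continuous_on_subset)
  then obtain a where a: "a \<in> {-R..R}" "\<And>x. x \<in> {-R..R} \<Longrightarrow> \<bar>u x\<bar> \<le> \<bar>u a\<bar>"
    using continuous_attains_sup[of "{-R..R}" "\<lambda>x. \<bar>u x\<bar>"] \<open>\<bar>p\<bar> < R\<close> by fastforce
  have pa: "\<bar>u p\<bar> \<le> \<bar>u a\<bar>" by (rule a(2)) (use \<open>\<bar>p\<bar> < R\<close> in auto)
  have "\<bar>u x\<bar> \<le> \<bar>u a\<bar>" for x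
  proof (cases "x \<in> {-R..R}")
    case False
    then have "\<bar>x\<bar> \<ge> R" by auto
    then show ?thesis using R pa by fastforce
  qed (rule a)
  with p pa show thesis by (intro that[of a]) auto
qed

text \<open>A value above the essential supremum would, by continuity, be approached on a nonempty open set,
  which is not a null set.\<close>

lemma Linf_norm_eq_max_abs:
  assumes u: "continuous_on UNIV u" and a: "\<And>x. \<bar>u x\<bar> \<le> \<bar>u a\<bar>"
  shows "Linf_norm u = \<bar>u a\<bar>"
proof -
  let ?e = "esssup lebesgue (\<lambda>x. ereal \<bar>u x\<bar>)"
  have [measurable]: "u \<in> borel_measurable lebesgue"
    using u by (intro measurable_completion) (simp add: borel_measurable_continuous_onI)
  have "?e \<le> ereal \<bar>u a\<bar>" using a by (intro esssup_I) auto
  moreover have "\<not> ?e < ereal \<bar>u a\<bar>"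
  proof
    assume "?e < ereal \<bar>u a\<bar>"
    then obtain r where r: "?e < ereal r" "r < \<bar>u a\<bar>"
      by (metis ereal_dense2 ereal_less_eq(3) less_ereal.simps(1))
    have "AE x in lebesgue. \<not> r < \<bar>u x\<bar>"
      using esssup_AE[of "\<lambda>x. ereal \<bar>u x\<bar>" lebesgue]
    proof eventually_elim
      case (elim x)
      then have "ereal \<bar>u x\<bar> < ereal r" using r(1) by (rule le_less_trans)
      then show ?case by simp
    qed
    moreover have opn: "open {x. r < \<bar>u x\<bar>}"
      by (intro open_Collect_less continuous_intros u)
    moreover have "{x. r < \<bar>u x\<bar>} \<in> sets lebesgue"
      using borel_open[OF opn] by (auto intro: sets_completionI_sets)
    ultimately have "{x. r < \<bar>u x\<bar>} \<in> null_sets lebesgue"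
      by (simp add: AE_iff_null_sets)
    with opn show False
      using open_not_negligible[of "{x. r < \<bar>u x\<bar>}"] r(2) by (auto simp: negligible_iff_null_sets)
  qed
  ultimately have "?e = ereal \<bar>u a\<bar>" by simp
  then show ?thesis by (simp add: Linf_norm_def)
qed

section \<open>Homogeneity of the energy\<close>

lemma has_weak_deriv_scale:
  assumes "has_weak_deriv u g"
  shows "has_weak_deriv (\<lambda>x. c * u x) (\<lambda>x. c * g x)"
  using assms by (simp add: has_weak_deriv_def locally_integrable_def mult.assoc)

lemma H1_weak_deriv: "u \<in> H1 \<Longrightarrow> has_weak_deriv u (weak_deriv u)"
  using someI_ex[of "has_weak_deriv u"] unfolding weak_deriv_def H1_def by blast

lemma H1_scale:
  assumes "u \<in> H1" shows "(\<lambda>x. c * u x) \<in> H1"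
proof -
  have "(\<lambda>x. c * f x) \<in> L2" if "f \<in> L2" for f
    using that borel_measurable_times[OF borel_measurable_const[of c], of f lebesgue]
    by (simp add: L2_def power_mult_distrib)
  then show ?thesis
    using assms has_weak_deriv_scale by (fastforce simp: H1_def intro!: continuous_intros)
qed

text \<open>The weak derivative chosen for \<open>c u\<close> is in general not \<open>c\<close> times the one chosen for \<open>u\<close>; the two
  agree only almost everywhere, which the integral does not see.\<close>

lemma V_norm_sq_scale:
  assumes u: "u \<in> H1" and [measurable]: "V \<in> borel_measurable lebesgue"
  shows "V_norm_sq V (\<lambda>x. c * u x) = c\<^sup>2 * V_norm_sq V u"
proof -
  have cu: "(\<lambda>x. c * u x) \<in> H1" by (rule H1_scale[OF u])
  have wd: "has_weak_deriv u (weak_deriv u)" "has_weak_deriv (\<lambda>x. c * u x) (weak_deriv (\<lambda>x. c * u x))"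
    using u cu by (auto intro: H1_weak_deriv)
  have [measurable]: "u \<in> borel_measurable lebesgue" "weak_deriv u \<in> borel_measurable lebesgue"
    "weak_deriv (\<lambda>x. c * u x) \<in> borel_measurable lebesgue"
    using u wd by (auto simp: H1_def L2_def has_weak_deriv_def intro: locally_integrable_measurable)
  have "AE x in lebesgue. weak_deriv (\<lambda>x. c * u x) x = c * weak_deriv u x"
    using cu by (intro weak_deriv_unique[OF _ wd(2) has_weak_deriv_scale[OF wd(1)]]) (simp add: H1_def)
  then have "V_norm_sq V (\<lambda>x. c * u x) = (\<integral>x. c\<^sup>2 * (\<bar>weak_deriv u x\<bar>\<^sup>2 + V x * \<bar>u x\<bar>\<^sup>2) \<partial>lebesgue)"
    unfolding V_norm_sq_def
    by (intro integral_cong_AE) (auto elim!: eventually_mono simp: power_mult_distrib algebra_simps)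
  then show ?thesis by (simp add: V_norm_sq_def)
qed

section \<open>Normalized members of the Sobolev space\<close>

lemma test_function_deriv:
  assumes "test_function \<phi>"
  shows "(\<phi> has_real_derivative deriv \<phi> x) (at x)" "continuous_on UNIV (deriv \<phi>)"
proof -
  have d: "(deriv ^^ k) \<phi> field_differentiable (at x)" for k x
    using assms by (simp add: test_function_def)
  show "(\<phi> has_real_derivative deriv \<phi> x) (at x)"
    using d[of 0] by (simp add: DERIV_deriv_iff_field_differentiable)
  show "continuous_on UNIV (deriv \<phi>)"
    using d[of 1] by (auto intro!: continuous_at_imp_continuous_on field_differentiable_imp_continuous_at)
qed

lemma continuous_imp_locally_integrable:
  assumes "continuous_on UNIV f" shows "locally_integrable f"
  unfolding locally_integrable_def
proof (intro allI impI)
  fix S :: "real set" assume S: "compact S"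
  then show "f absolutely_integrable_on S"
    unfolding set_integrable_def
    using borel_integrable_compact[OF S continuous_on_subset[OF assms]]
    by (intro integrable_completion[THEN iffD2]) (auto simp: mult.commute)
qed

lemma has_weak_deriv_continuously_differentiable:
  fixes u u' :: "real \<Rightarrow> real"
  assumes u: "\<And>x. (u has_real_derivative u' x) (at x)" and u': "continuous_on UNIV u'"
  shows "has_weak_deriv u u'"
  unfolding has_weak_deriv_def
proof (intro conjI allI impI)
  have cu: "continuous_on UNIV u"
    using u by (blast intro: DERIV_isCont continuous_at_imp_continuous_on)
  then show "locally_integrable u" "locally_integrable u'"
    using u' by (auto intro: continuous_imp_locally_integrable)
  fix \<phi> assume \<phi>: "test_function \<phi>"
  note d\<phi> = test_function_deriv[OF \<phi>]
  have c\<phi>: "continuous_on UNIV \<phi>"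
    using d\<phi>(1) by (blast intro: DERIV_isCont continuous_at_imp_continuous_on)
  have "bounded {x. \<phi> x \<noteq> 0}"
    using \<phi> compact_imp_bounded bounded_subset closure_subset unfolding test_function_def by blast
  then obtain B where B: "\<And>x. \<phi> x \<noteq> 0 \<Longrightarrow> \<bar>x\<bar> \<le> B" by (auto simp: bounded_iff)
  define b where "b = \<bar>B\<bar> + 1"
  have supp: "\<phi> x = 0" if "x \<notin> {-b<..<b}" for x
    using B[of x] that by (cases "\<phi> x = 0") (auto simp: b_def)
  have supp': "deriv \<phi> x = 0" if "x \<notin> {-b..b}" for x
    using that by (intro deriv_eq_0_locally_constant[of "- {-b..b}" x \<phi> 0] supp) auto
  have cont: "isCont f x" if "continuous_on UNIV f" for f :: "real \<Rightarrow> real" and x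
    using that by (simp add: continuous_on_eq_continuous_at)
  have restrict: "(\<integral>x. f x \<partial>lebesgue) = (\<integral>x. f x * indicator {-b..b} x \<partial>lborel)"
    if "continuous_on UNIV f" and f0: "\<And>x. x \<notin> {-b..b} \<Longrightarrow> f x = 0" for f :: "real \<Rightarrow> real"
  proof -
    have "f x = f x * indicator {-b..b} x" for x
      using f0[of x] by (cases "x \<in> {-b..b}") simp_all
    then show ?thesis
      using lebesgue_integral_lborel[OF that(1)] Bochner_Integration.integral_cong[OF refl, of lborel f] by metis
  qed
  have "(\<integral>x. u x * deriv \<phi> x \<partial>lebesgue) = (\<integral>x. (u x * deriv \<phi> x) * indicator {-b..b} x \<partial>lborel)"
    using supp' by (intro restrict continuous_intros cu d\<phi>(2)) simp
  also have "\<dots> = u b * \<phi> b - u (-b) * \<phi> (-b) - (\<integral>x. (u' x * \<phi> x) * indicator {-b..b} x \<partial>lborel)"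
    by (intro integral_by_parts cont u' u d\<phi>) (simp add: b_def)
  also have "\<dots> = - (\<integral>x. (u' x * \<phi> x) * indicator {-b..b} x \<partial>lborel)"
    by (simp add: supp)
  also have "(\<integral>x. (u' x * \<phi> x) * indicator {-b..b} x \<partial>lborel) = (\<integral>x. u' x * \<phi> x \<partial>lebesgue)"
  proof (intro restrict[symmetric] continuous_intros c\<phi> u')
    fix x assume "x \<notin> {-b..b}"
    then have "\<phi> x = 0" by (intro supp) auto
    then show "u' x * \<phi> x = 0" by simp
  qed
  finally show "(\<integral>x. u x * deriv \<phi> x \<partial>lebesgue) = - (\<integral>x. u' x * \<phi> x \<partial>lebesgue)" .
qed

text \<open>The witness is the smooth bump \<open>step (t - a + 1) * step (a + 1 - t)\<close>, supported in
  \<open>{a - 1..a + 1}\<close>; at \<open>t = a\<close> both factors equal \<open>1\<close>, their maximal value.\<close>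

lemma K_nonempty: "K a \<noteq> {}"
proof -
  define w where "w t = step (t - a + 1) * step (a + 1 - t)" for t
  have "times_differentiable 2 (\<lambda>t. step (1 * t + (1 - a)) * step ((-1) * t + (a + 1)))"
    by (intro times_differentiable_mult times_differentiable_affine times_differentiable_step)
  then have w: "times_differentiable (Suc 1) w"
    by (simp add: w_def[abs_def] algebra_simps numeral_2_eq_2 del: times_differentiable.simps)
  have dw: "(w has_real_derivative deriv w x) (at x)" for x
    using w by (auto simp: DERIV_deriv_iff_real_differentiable real_differentiable_def)
  then have cw: "continuous_on UNIV w"
    by (blast intro: DERIV_isCont continuous_at_imp_continuous_on)
  have cw': "continuous_on UNIV (deriv w)"
    using times_differentiable_deriv[OF w] by (auto intro: DERIV_isCont continuous_at_imp_continuous_on)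
  have supp: "w t = 0" if "t \<notin> {a-1..a+1}" for t
    using that by (auto simp: w_def step_eq_0)
  have supp': "deriv w t = 0" if "t \<notin> {a-1..a+1}" for t
    using that by (intro deriv_eq_0_locally_constant[of "- {a-1..a+1}" t w 0] supp) auto
  have L2: "f \<in> L2" if "continuous_on UNIV f" "\<And>t. t \<notin> {a-1..a+1} \<Longrightarrow> f t = 0" for f
    unfolding L2_def
  proof (intro CollectI conjI)
    show "f \<in> borel_measurable lebesgue"
      using that(1) by (intro measurable_completion) (simp add: borel_measurable_continuous_onI)
    show "integrable lebesgue (\<lambda>x. \<bar>f x\<bar>\<^sup>2)"
      using that by (intro integrable_compact_support[of _ "a-1" "a+1"] continuous_intros) auto
  qed
  have "w \<in> H1"
    using cw L2[OF cw supp] L2[OF cw' supp'] has_weak_deriv_continuously_differentiable[OF dw cw']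
    by (auto simp: H1_def)
  moreover have "w a = 1" by (simp add: w_def step_eq_1)
  moreover have "\<bar>w x\<bar> \<le> \<bar>w a\<bar>" for x
    using \<open>w a = 1\<close> step_nonneg step_le_1 by (simp add: w_def abs_mult mult_le_one)
  then have "Linf_norm w = 1"
    using Linf_norm_eq_max_abs[OF cw, of a] \<open>w a = 1\<close> by simp
  ultimately have "w \<in> K a" by (simp add: K_def)
  then show ?thesis by blast
qed

section \<open>The two infima agree\<close>

lemma V_norm_sq_nonneg:
  assumes "AE x in lebesgue. 0 \<le> V x" shows "V_norm_sq V u \<ge> 0"
  unfolding V_norm_sq_def by (rule integral_nonneg_AE) (use assms in \<open>auto elim: eventually_mono\<close>)

theorem proposition2p1:
  fixes V :: "real \<Rightarrow> real" and v\<^sub>0 v\<^sub>1 :: real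
  assumes "V \<in> Linf"
    and "0 < v\<^sub>0"
    and "AE x in lebesgue. v\<^sub>0 \<le> V x \<and> V x \<le> v\<^sub>1"
  shows "m V = (INF a\<in>UNIV. F V a)"
proof (rule antisym)
  have nonneg: "V_norm_sq V u \<ge> 0" for u
    using assms(2,3) by (intro V_norm_sq_nonneg) (auto elim!: eventually_mono)
  have V: "V \<in> borel_measurable lebesgue" using assms(1) by (simp add: Linf_def)
  let ?q = "\<lambda>u. V_norm_sq V u / (Linf_norm u)\<^sup>2"
  have bdd_K: "bdd_below (V_norm_sq V ` K a)" for a
    using nonneg by (intro bdd_belowI2[of _ 0])
  have K_sub: "u \<in> H1" "u \<noteq> (\<lambda>_. 0)" "?q u = V_norm_sq V u" if "u \<in> K a" for u a
    using that by (auto simp: K_def)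
  show "m V \<le> (INF a\<in>UNIV. F V a)"
    unfolding m_def F_def
  proof (intro cINF_greatest K_nonempty)
    fix a u assume u: "u \<in> K a"
    have "(INF u\<in>{u \<in> H1. u \<noteq> (\<lambda>_. 0)}. ?q u) \<le> ?q u"
      using K_sub[OF u] nonneg by (intro cINF_lower bdd_belowI2[of _ 0]) auto
    then show "(INF u\<in>{u \<in> H1. u \<noteq> (\<lambda>_. 0)}. ?q u) \<le> V_norm_sq V u"
      using K_sub(3)[OF u] by simp
  qed auto
  show "(INF a\<in>UNIV. F V a) \<le> m V"
    unfolding m_def
  proof (rule cINF_greatest)
    show "{u \<in> H1. u \<noteq> (\<lambda>_. 0)} \<noteq> {}" using K_nonempty K_sub by blast
    fix u assume "u \<in> {u \<in> H1. u \<noteq> (\<lambda>_. 0)}"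
    then have u: "u \<in> H1" "u \<noteq> (\<lambda>_. 0)" by auto
    then obtain a where a: "u a \<noteq> 0" "\<And>x. \<bar>u x\<bar> \<le> \<bar>u a\<bar>"
      using H1_attains_max_abs by blast
    define w where "w x = (1 / u a) * u x" for x
    have wH1: "w \<in> H1" unfolding w_def[abs_def] by (rule H1_scale[OF u(1)])
    have "\<bar>w x\<bar> \<le> \<bar>w a\<bar>" for x
      using a by (simp add: w_def)
    then have "Linf_norm w = 1"
      using Linf_norm_eq_max_abs[of w a] wH1 a(1) by (simp add: H1_def w_def)
    with wH1 a(1) have "w \<in> K a" by (simp add: K_def w_def)
    have "(INF a\<in>UNIV. F V a) \<le> F V a"
      unfolding F_def using nonneg
      by (intro cINF_lower bdd_belowI2[of _ 0] cINF_greatest K_nonempty) auto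
    also have "\<dots> \<le> V_norm_sq V w"
      unfolding F_def using \<open>w \<in> K a\<close> by (intro cINF_lower bdd_K)
    also have "\<dots> = (1 / u a)\<^sup>2 * V_norm_sq V u"
      unfolding w_def[abs_def] by (rule V_norm_sq_scale[OF u(1) V])
    also have "\<dots> = ?q u"
      using Linf_norm_eq_max_abs[of u a] u(1) a(2) by (simp add: H1_def power_divide)
    finally show "(INF a\<in>UNIV. F V a) \<le> ?q u" .
  qed
qed

end
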